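(* Let $n\ge 2$. There is a constant $C_4=C_4(n)$ depending only on $n$ such that, for every $\delta>0$ and $K\ge 0$, there is a positive constant $C_3$ depending only on $n$, $\delta$ and $K$ for which the following holds. Let $R>0$, let $\psi\in C^{1,1}(B_{3R}(0))$, $B_{3R}(0)\subset\mathbb{R}^n$, satisfy $|\psi(x)|\ge (n-2)\frac{\pi}{2}+\delta$ for all $x\in B_{3R}(0)$ and $\|\psi\|_{C^1(B_{3R})}\le K$, and let $u\in C^3(B_{3R}(0))$ be a solution of $$\sum_{i=1}^n\arctan\lambda_i(x)=\psi(x)\quad\text{in } B_{3R}(0),$$ where $\lambda_1(x),\dots,\lambda_n(x)$ are the eigenvalues of the Hessian matrix $D^2u(x)$. Then $$\max_{B_R(0)}|Du|\le C_3\,\operatorname{osc}_{B_{3R}(0)}\frac{u}{R}+C_4(n).$$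
   Context: $B_r(0)$ is the open ball of radius $r$ centered at $0$ in $\mathbb{R}^n$; $Du$ is the gradient of $u$; $\max_{B_R(0)}$ denotes the supremum over $B_R(0)$. $\operatorname{osc}_{B}f=\sup_B f-\inf_B f$ is the oscillation of $f$ on $B$ (if it is infinite the estimate is vacuous). $\|\psi\|_{C^1(B_{3R})}=\sup_{B_{3R}}|\psi|+\sup_{B_{3R}}|D\psi|$. *)

theory Defs
  imports "HOL-Analysis.Analysis"
begin

text \<open>
  Functions are total on \<open>real ^ 'n\<close>, but all notions below are only evaluated at points of an
  open set, where the derivatives depend on the values of the function in that set alone.
\<close>

definition partial :: "'n \<Rightarrow> (real ^ 'n \<Rightarrow> real) \<Rightarrow> real ^ 'n::finite \<Rightarrow> real" where
  "partial i f x = frechet_derivative f (at x) (axis i 1)"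

definition grad :: "(real ^ 'n \<Rightarrow> real) \<Rightarrow> real ^ 'n::finite \<Rightarrow> real ^ 'n" where
  "grad f x = (\<chi> i. partial i f x)"

definition hessian :: "(real ^ 'n \<Rightarrow> real) \<Rightarrow> real ^ 'n::finite \<Rightarrow> real ^ 'n ^ 'n" where
  "hessian f x = (\<chi> i j. partial i (partial j f) x)"

text \<open>The class \<open>C\<^sup>k(S)\<close> for open \<open>S\<close>; no boundedness up to the boundary is required.\<close>

primrec C_on :: "nat \<Rightarrow> (real ^ 'n::finite) set \<Rightarrow> (real ^ 'n \<Rightarrow> real) \<Rightarrow> bool" where
  "C_on 0 S f \<longleftrightarrow> continuous_on S f"
| "C_on (Suc k) S f \<longleftrightarrow> (\<forall>x\<in>S. f differentiable (at x)) \<and> (\<forall>i. C_on k S (partial i f))"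

text \<open>
  \<open>C\<^sup>1\<^sup>,\<^sup>1(S)\<close> for open \<open>S\<close>, with the usual convention for Hoelder spaces on an open set: the
  Lipschitz condition on the gradient is uniform on compact subsets. In particular every function
  whose gradient is Lipschitz on all of \<open>S\<close> belongs to this class.
\<close>

definition C11_on :: "(real ^ 'n::finite) set \<Rightarrow> (real ^ 'n \<Rightarrow> real) \<Rightarrow> bool" where
  "C11_on S f \<longleftrightarrow> C_on 1 S f \<and> (\<forall>T. compact T \<and> T \<subseteq> S \<longrightarrow> (\<exists>L. L-lipschitz_on T (grad f)))"

text \<open>Suprema and infima are taken in \<open>ereal\<close>, so that unbounded functions get an infinite norm
  or oscillation.\<close>

definition C1_norm :: "(real ^ 'n::finite) set \<Rightarrow> (real ^ 'n \<Rightarrow> real) \<Rightarrow> ereal" where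
  "C1_norm S f = (SUP x\<in>S. ereal \<bar>f x\<bar>) + (SUP x\<in>S. ereal (norm (grad f x)))"

definition osc :: "'a set \<Rightarrow> ('a \<Rightarrow> real) \<Rightarrow> ereal" where
  "osc S f = (SUP x\<in>S. ereal (f x)) - (INF x\<in>S. ereal (f x))"

text \<open>
  The family \<open>\<lambda>\<close> lists the eigenvalues of \<open>A\<close>, i.e. the roots of its characteristic polynomial,
  with multiplicity. It is unique up to permutation, and exists for every symmetric \<open>A\<close>.
\<close>

definition eigenvalues :: "real ^ 'n ^ 'n \<Rightarrow> ('n::finite \<Rightarrow> real) \<Rightarrow> bool" where
  "eigenvalues A lam \<longleftrightarrow> (\<forall>t. det (mat t - A) = (\<Prod>i\<in>UNIV. t - lam i))"

definition lagrangian_phase_solution ::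
    "(real ^ 'n::finite) set \<Rightarrow> (real ^ 'n \<Rightarrow> real) \<Rightarrow> (real ^ 'n \<Rightarrow> real) \<Rightarrow> bool" where
  "lagrangian_phase_solution S \<psi> u \<longleftrightarrow>
     (\<forall>x\<in>S. \<exists>lam. eigenvalues (hessian u x) lam \<and> (\<Sum>i\<in>UNIV. arctan (lam i)) = \<psi> x)"

end

theory Submission
  imports Defs
begin

text \<open>
  The estimate holds with \<open>C\<^sub>4 = 0\<close> and, when \<open>\<delta> < \<pi>\<close>, \<open>C\<^sub>3 = 1 + n \<bar>cot \<delta>\<bar> / (2 \<delta>)\<close>; for
  \<open>\<delta> \<ge> \<pi>\<close> the equation has no solutions, since its left side is below \<open>n \<pi>/2\<close> in absolute value. On the ball, \<open>\<psi>\<close> is continuous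
  with \<open>\<bar>\<psi>\<bar> \<ge> (n - 2) \<pi>/2 + \<delta> > 0\<close>, so it has a constant sign; replacing \<open>u\<close> by \<open>-u\<close>, which turns the eigenvalues
  \<open>\<lambda>\<^sub>i\<close> into \<open>-\<lambda>\<^sub>i\<close>, one may assume \<open>\<psi> > 0\<close>. Supercriticality of the phase then has two
  consequences at each point.

  First, every \<open>arctan \<lambda>\<^sub>j\<close> is below \<open>\<pi>/2\<close>, so \<open>arctan \<lambda>\<^sub>i \<ge> \<delta> - \<pi>/2\<close> for each \<open>i\<close>.
  Thus all eigenvalues are at least \<open>-c\<close> with \<open>c = \<bar>cot \<delta>\<bar>\<close>: the function \<open>u\<close> is semiconvex. Taylor's
  formula from \<open>x \<in> B\<^sub>R\<close> to the point at distance \<open>R\<close> in the direction of \<open>Du(x)\<close> gives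
  \<open>R \<bar>Du(x)\<bar> \<le> osc u + c R\<^sup>2 / 2\<close> (\<open>second_order_lower_bound\<close>).

  Second, not all eigenvalues can be small, because \<open>arctan t \<le> t\<close> for \<open>t \<ge> 0\<close>: one of them exceeds
  \<open>2 \<epsilon>\<close> with \<open>\<epsilon> = \<delta> / (4 n)\<close>. So \<open>u - \<epsilon> \<bar>x\<bar>\<^sup>2\<close> has no interior local maximum, and its maximum over the
  closed ball of radius \<open>2 R\<close> lies on the boundary, which forces \<open>osc u \<ge> 4 \<epsilon> R\<^sup>2\<close>
  (\<open>quadratic_growth\<close>). The error \<open>c R / 2\<close> of the first step is therefore
  itself at most \<open>c / (8 \<epsilon>)\<close> times \<open>osc u / R\<close>, whatever the size of \<open>R\<close>.

  Eigenvalues are given as roots of the characteristic polynomial. To turn a lower bound for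
  them into one for the quadratic form, the Hessian must be symmetric
  (\<open>symmetric_second_derivative\<close>); the minimum of the form on the unit sphere is
  then an eigenvalue (\<open>exists_eigenvector_minimizing_quadratic_form\<close>).
\<close>

section \<open>Eigenvalues and quadratic forms\<close>

lemma mem_range_eigenvalues_iff:
  fixes A :: "real ^ 'n::finite ^ 'n"
  assumes "eigenvalues A lam"
  shows "\<mu> \<in> range lam \<longleftrightarrow> (\<exists>v. v \<noteq> 0 \<and> A *v v = \<mu> *\<^sub>R v)"
proof -
  have "\<mu> \<in> range lam \<longleftrightarrow> (\<Prod>i\<in>UNIV. \<mu> - lam i) = 0"
    by (auto simp: prod_zero_iff)
  also have "\<dots> \<longleftrightarrow> det (mat \<mu> - A) = 0"
    using assms by (simp add: eigenvalues_def)
  also have "\<dots> \<longleftrightarrow> \<not> (\<exists>B. B ** (mat \<mu> - A) = mat 1)"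
    by (metis invertible_det_nz invertible_left_inverse)
  also have "\<dots> \<longleftrightarrow> (\<exists>v. v \<noteq> 0 \<and> (mat \<mu> - A) *v v = 0)"
    by (auto simp: matrix_left_invertible_ker)
  also have "\<dots> \<longleftrightarrow> (\<exists>v. v \<noteq> 0 \<and> A *v v = \<mu> *\<^sub>R v)"
  proof -
    have "mat \<mu> *v v = \<mu> *\<^sub>R v" for v :: "real ^ 'n"
      by (simp add: vec_eq_iff matrix_vector_mult_def mat_def if_distrib if_distribR sum.delta cong: if_cong)
    then show ?thesis
      by (auto simp: matrix_vector_mult_diff_rdistrib)
  qed
  finally show ?thesis .
qed

lemma eigenvalues_le:
  fixes A :: "real ^ 'n::finite ^ 'n"
  assumes "eigenvalues A lam" and "\<And>v. v \<bullet> (A *v v) \<le> b * (v \<bullet> v)"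
  shows "lam i \<le> b"
proof -
  obtain v where v: "v \<noteq> 0" "A *v v = lam i *\<^sub>R v"
    using mem_range_eigenvalues_iff[OF assms(1)] by blast
  have "lam i * (v \<bullet> v) \<le> b * (v \<bullet> v)"
    using assms(2)[of v] v(2) by simp
  then show ?thesis
    using v(1) by simp
qed

text \<open>
  A minimizer \<open>v\<close> of \<open>x \<bullet> A x\<close> on the compact unit sphere, with minimum \<open>\<mu>\<close>, is a zero of the nonnegative form
  \<open>q(x) = x \<bullet> A x - \<mu> (x \<bullet> x)\<close>. If \<open>w = A v - \<mu> v\<close> were nonzero, moving from \<open>v\<close> slightly in the
  direction \<open>-w\<close> would make \<open>q\<close> negative. Symmetry makes \<open>2 w\<close> the gradient of \<open>q\<close> at \<open>v\<close>.
\<close>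

lemma exists_eigenvector_minimizing_quadratic_form:
  fixes A :: "real ^ 'n::finite ^ 'n"
  assumes sym: "\<And>v w. v \<bullet> (A *v w) = w \<bullet> (A *v v)"
  shows "\<exists>\<mu> v. v \<noteq> 0 \<and> A *v v = \<mu> *\<^sub>R v \<and> (\<forall>x. \<mu> * (x \<bullet> x) \<le> x \<bullet> (A *v x))"
proof -
  have "continuous_on (sphere 0 1) (\<lambda>x. x \<bullet> (A *v x))"
    by (intro continuous_intros matrix_vector_mult_linear_continuous_on)
  moreover have "sphere (0 :: real ^ 'n) 1 \<noteq> {}"
    by simp
  ultimately obtain v where v: "norm v = 1" and min: "\<And>x. norm x = 1 \<Longrightarrow> v \<bullet> (A *v v) \<le> x \<bullet> (A *v x)"
    using continuous_attains_inf[OF compact_sphere, of 0 1 "\<lambda>x. x \<bullet> (A *v x)"] by auto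
  define \<mu> where "\<mu> = v \<bullet> (A *v v)"
  define q where "q x = x \<bullet> (A *v x) - \<mu> * (x \<bullet> x)" for x
  have q_nonneg: "q x \<ge> 0" for x
  proof (cases "x = 0")
    case False
    have "\<mu> \<le> sgn x \<bullet> (A *v sgn x)"
      unfolding \<mu>_def using False by (intro min) (simp add: norm_sgn)
    also have "\<dots> = (x \<bullet> (A *v x)) / (x \<bullet> x)"
      by (simp add: sgn_div_norm matrix_vector_mult_scaleR divide_inverse power2_eq_square dot_square_norm
          mult.assoc)
    finally show ?thesis
      using False by (simp add: q_def pos_le_divide_eq)
  qed (simp add: q_def)
  define w where "w = A *v v - \<mu> *\<^sub>R v"
  have q_line: "q (v + t *\<^sub>R w) = 2 * t * (w \<bullet> w) + t\<^sup>2 * q w" for t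
  proof -
    have "q (v + t *\<^sub>R w) = q v + t * (v \<bullet> (A *v w) + w \<bullet> (A *v v) - 2 * \<mu> * (v \<bullet> w)) + t\<^sup>2 * q w"
      unfolding q_def matrix_vector_right_distrib matrix_vector_mult_scaleR inner_add_left inner_add_right
        inner_scaleR_left inner_scaleR_right inner_commute[of w v] power2_eq_square
      by algebra
    moreover have "q v = 0"
      using v by (simp add: q_def \<mu>_def dot_square_norm)
    moreover have "v \<bullet> (A *v w) + w \<bullet> (A *v v) - 2 * \<mu> * (v \<bullet> w) = 2 * (w \<bullet> w)"
      using sym[of v w] by (simp add: w_def inner_diff_right inner_diff_left inner_commute algebra_simps)
    ultimately show ?thesis by simp
  qed
  have "w = 0"
  proof (rule ccontr)
    assume "w \<noteq> 0"
    then have ww: "w \<bullet> w > 0" by simp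
    \<comment> \<open>For \<open>q w > 0\<close> the polynomial \<open>2 t (w \<bullet> w) + t\<^sup>2 q(w)\<close> has its minimum at \<open>- (w \<bullet> w) / q w\<close>; the
      \<open>1\<close> added to the denominator covers \<open>q w = 0\<close> and keeps the value negative.\<close>
    define t where "t = - (w \<bullet> w) / (1 + q w)"
    have pos: "1 + q w > 0" using q_nonneg[of w] by simp
    have t: "t < 0" using ww pos by (simp add: t_def divide_neg_pos)
    have "t * (1 + q w) = - (w \<bullet> w)"
      using pos by (simp add: t_def)
    then have "t * q w = - (w \<bullet> w) - t" by (simp add: algebra_simps)
    then have "2 * (w \<bullet> w) + t * q w = w \<bullet> w - t" by simp
    then have "2 * (w \<bullet> w) + t * q w > 0" using ww t by linarith
    then have "t * (2 * (w \<bullet> w) + t * q w) < 0" using t by (simp add: mult_neg_pos)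
    then have "q (v + t *\<^sub>R w) < 0" by (simp add: q_line power2_eq_square algebra_simps)
    with q_nonneg[of "v + t *\<^sub>R w"] show False by simp
  qed
  then have "A *v v = \<mu> *\<^sub>R v" by (simp add: w_def)
  moreover have "v \<noteq> 0" using v by auto
  moreover have "\<forall>x. \<mu> * (x \<bullet> x) \<le> x \<bullet> (A *v x)"
    using q_nonneg by (simp add: q_def)
  ultimately show ?thesis by blast
qed

lemma quadratic_form_ge:
  fixes A :: "real ^ 'n::finite ^ 'n"
  assumes "\<And>v w. v \<bullet> (A *v w) = w \<bullet> (A *v v)"
    and "eigenvalues A lam" and "\<And>i. b \<le> lam i"
  shows "b * (x \<bullet> x) \<le> x \<bullet> (A *v x)"
proof -
  obtain \<mu> v where "v \<noteq> 0" "A *v v = \<mu> *\<^sub>R v" and \<mu>: "\<And>x. \<mu> * (x \<bullet> x) \<le> x \<bullet> (A *v x)"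
    using exists_eigenvector_minimizing_quadratic_form[OF assms(1)] by blast
  then have "\<mu> \<in> range lam"
    using mem_range_eigenvalues_iff[OF assms(2)] by blast
  then have "b \<le> \<mu>" using assms(3) by auto
  then have "b * (x \<bullet> x) \<le> \<mu> * (x \<bullet> x)" by (intro mult_right_mono) auto
  then show ?thesis using \<mu>[of x] by simp
qed

lemma eigenvalues_uminus:
  fixes A :: "real ^ 'n::finite ^ 'n"
  assumes "eigenvalues A lam"
  shows "eigenvalues (- A) (\<lambda>i. - lam i)"
  unfolding eigenvalues_def
proof
  fix t
  have "mat t - (- A) = (\<chi> i. (- 1) *s (mat (- t) - A) $ i)"
    by (simp add: vec_eq_iff mat_def)
  then have "det (mat t - (- A)) = (- 1) ^ CARD('n) * det (\<chi> i. (mat (- t) - A) $ i)"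
    by (simp only: det_rows_mul prod_constant)
  then have "det (mat t - (- A)) = (- 1) ^ CARD('n) * det (mat (- t) - A)"
    by (simp only: vec_lambda_eta)
  also have "\<dots> = (\<Prod>i\<in>UNIV. (- 1) * (- t - lam i))"
    unfolding prod.distrib prod_constant using assms by (simp add: eigenvalues_def)
  finally show "det (mat t - (- A)) = (\<Prod>i\<in>UNIV. t - - lam i)"
    by (simp add: add.commute)
qed

section \<open>Second derivatives along lines\<close>

lemma has_real_derivative_along_line:
  fixes F :: "'a::real_inner \<Rightarrow> real"
  assumes "(F has_derivative (\<lambda>h. g \<bullet> h)) (at (x + t *\<^sub>R v))"
  shows "((\<lambda>t. F (x + t *\<^sub>R v)) has_real_derivative g \<bullet> v) (at t)"
proof -
  have "((\<lambda>t. x + t *\<^sub>R v) has_derivative (\<lambda>h. h *\<^sub>R v)) (at t)"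
    by (auto intro!: derivative_eq_intros)
  from diff_chain_at[OF this assms] show ?thesis
    by (simp add: o_def has_field_derivative_def mult.commute[of "g \<bullet> v"] mult_commute_abs)
qed

lemma has_real_derivative_gradient_along_line:
  fixes G :: "real ^ 'n::finite \<Rightarrow> real ^ 'n"
  assumes "(G has_derivative (\<lambda>h. A *v h)) (at (x + t *\<^sub>R v))"
  shows "((\<lambda>t. G (x + t *\<^sub>R v) \<bullet> w) has_real_derivative w \<bullet> (A *v v)) (at t)"
proof -
  have "((\<lambda>y. G y \<bullet> w) has_derivative (\<lambda>h. (w v* A) \<bullet> h)) (at (x + t *\<^sub>R v))"
    using has_derivative_inner_left[OF assms, of w]
    by (simp only: dot_lmul_matrix inner_commute[of w])
  from has_real_derivative_along_line[OF this] show ?thesis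
    by (simp add: dot_lmul_matrix)
qed

text \<open>
  The mixed second difference of \<open>F\<close> over the parallelogram spanned by \<open>s v\<close> and \<open>s w\<close> is, by the mean value
  theorem applied to \<open>t \<mapsto> F(x + t v + s w) - F(x + t v)\<close>, equal to \<open>s\<close> times the \<open>v\<close>-component of an
  increment of \<open>G\<close> by \<open>s w\<close>. Differentiability of \<open>G\<close> at the single point \<open>x\<close> evaluates this increment
  up to an error of order \<open>e s\<close>.
\<close>

lemma second_difference_approx:
  fixes F :: "real ^ 'n::finite \<Rightarrow> real"
  assumes "open S" "x \<in> S"
    and dF: "\<And>y. y \<in> S \<Longrightarrow> (F has_derivative (\<lambda>h. G y \<bullet> h)) (at y)"
    and dG: "(G has_derivative (\<lambda>h. A *v h)) (at x)"
    and e: "e > 0"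
  shows "\<forall>\<^sub>F s in at_right 0. \<bar>F (x + s *\<^sub>R v + s *\<^sub>R w) - F (x + s *\<^sub>R v) - F (x + s *\<^sub>R w) + F x
           - s\<^sup>2 * (v \<bullet> (A *v w))\<bar> \<le> s\<^sup>2 * (2 * e * (norm v + norm w)\<^sup>2)"
proof -
  obtain d1 where d1: "d1 > 0" and near: "\<And>y. norm (y - x) < d1 \<Longrightarrow> norm (G y - G x - A *v (y - x)) \<le> e * norm (y - x)"
    using dG e unfolding has_derivative_at_alt by blast
  obtain d2 where d2: "d2 > 0" and ball: "ball x d2 \<subseteq> S"
    using assms(1,2) openE by blast
  define M where "M = norm v + norm w"
  have M: "M \<ge> 0" by (simp add: M_def)
  define d where "d = min d1 d2 / (1 + M)"
  have d: "d > 0" using d1 d2 M by (simp add: d_def)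
  show ?thesis
    unfolding eventually_at_right_field M_def[symmetric]
  proof (intro exI conjI allI impI)
    show "0 < d" by (fact d)
    fix s :: real assume s: "0 < s" "s < d"
    have sM: "s * M < min d1 d2"
    proof -
      have "s * M \<le> s * (1 + M)" using s by simp
      also have "\<dots> < min d1 d2" using s M by (simp add: d_def pos_less_divide_eq)
      finally show ?thesis .
    qed
    have small: "norm (t *\<^sub>R v + r *\<^sub>R w) \<le> s * M" if "0 \<le> t" "t \<le> s" "0 \<le> r" "r \<le> s" for t r
    proof -
      have "norm (t *\<^sub>R v + r *\<^sub>R w) \<le> t * norm v + r * norm w"
        using norm_triangle_ineq[of "t *\<^sub>R v" "r *\<^sub>R w"] that by simp
      also have "\<dots> \<le> s * norm v + s * norm w"
        using that by (intro add_mono mult_right_mono) simp_all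
      finally show ?thesis by (simp add: M_def distrib_left)
    qed
    have inS: "x + t *\<^sub>R v + r *\<^sub>R w \<in> S" if "0 \<le> t" "t \<le> s" "0 \<le> r" "r \<le> s" for t r
      using small[OF that] sM ball by (auto simp: subset_iff dist_norm norm_minus_commute algebra_simps)
    have "\<exists>\<tau>>0. \<tau> < s \<and> (F (x + s *\<^sub>R w + s *\<^sub>R v) - F (x + s *\<^sub>R v)) - (F (x + s *\<^sub>R w + 0 *\<^sub>R v) - F (x + 0 *\<^sub>R v))
        = (s - 0) * (G (x + s *\<^sub>R w + \<tau> *\<^sub>R v) \<bullet> v - G (x + \<tau> *\<^sub>R v) \<bullet> v)"
    proof (intro MVT2 s DERIV_diff has_real_derivative_along_line dF)
      fix t assume t: "0 \<le> t" "t \<le> s"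
      show "x + s *\<^sub>R w + t *\<^sub>R v \<in> S" using inS[OF t, of s] s by (simp add: algebra_simps)
      show "x + t *\<^sub>R v \<in> S" using inS[OF t, of 0] s by simp
    qed
    then obtain \<tau> where \<tau>: "0 < \<tau>" "\<tau> < s"
      and eq: "F (x + s *\<^sub>R v + s *\<^sub>R w) - F (x + s *\<^sub>R v) - F (x + s *\<^sub>R w) + F x
        = s * ((G (x + \<tau> *\<^sub>R v + s *\<^sub>R w) - G (x + \<tau> *\<^sub>R v)) \<bullet> v)"
      by (auto simp: inner_diff_left algebra_simps)
    define E where "E y = G y - G x - A *v (y - x)" for y
    have E: "norm (E (x + \<tau> *\<^sub>R v + r *\<^sub>R w)) \<le> e * (s * M)" if "0 \<le> r" "r \<le> s" for r
    proof -
      have *: "norm (\<tau> *\<^sub>R v + r *\<^sub>R w) \<le> s * M" using small[of \<tau> r] \<tau> that by simp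
      have "norm (E (x + \<tau> *\<^sub>R v + r *\<^sub>R w)) \<le> e * norm (\<tau> *\<^sub>R v + r *\<^sub>R w)"
        using near[of "x + \<tau> *\<^sub>R v + r *\<^sub>R w"] * sM by (simp add: E_def add.assoc)
      also have "\<dots> \<le> e * (s * M)" using * e by simp
      finally show ?thesis .
    qed
    have split: "G (x + \<tau> *\<^sub>R v + s *\<^sub>R w) - G (x + \<tau> *\<^sub>R v)
        = s *\<^sub>R (A *v w) + (E (x + \<tau> *\<^sub>R v + s *\<^sub>R w) - E (x + \<tau> *\<^sub>R v))"
      by (simp add: E_def add.assoc matrix_vector_right_distrib matrix_vector_mult_scaleR)
    have "\<bar>F (x + s *\<^sub>R v + s *\<^sub>R w) - F (x + s *\<^sub>R v) - F (x + s *\<^sub>R w) + F x - s\<^sup>2 * (v \<bullet> (A *v w))\<bar>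
        = s * \<bar>(E (x + \<tau> *\<^sub>R v + s *\<^sub>R w) - E (x + \<tau> *\<^sub>R v)) \<bullet> v\<bar>"
    proof -
      have "s * ((s *\<^sub>R (A *v w) + z) \<bullet> v) - s\<^sup>2 * (v \<bullet> (A *v w)) = s * (z \<bullet> v)" for z
        by (simp add: inner_add_left inner_commute power2_eq_square algebra_simps)
      then show ?thesis
        unfolding eq split using s by (simp add: abs_mult)
    qed
    also have "\<dots> \<le> s * ((2 * e * (s * M)) * M)"
    proof -
      have "\<bar>(E (x + \<tau> *\<^sub>R v + s *\<^sub>R w) - E (x + \<tau> *\<^sub>R v)) \<bullet> v\<bar>
          \<le> norm (E (x + \<tau> *\<^sub>R v + s *\<^sub>R w) - E (x + \<tau> *\<^sub>R v)) * norm v"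
        by (rule Cauchy_Schwarz_ineq2)
      also have "\<dots> \<le> (2 * e * (s * M)) * M"
      proof (rule mult_mono)
        show "norm (E (x + \<tau> *\<^sub>R v + s *\<^sub>R w) - E (x + \<tau> *\<^sub>R v)) \<le> 2 * e * (s * M)"
          using norm_triangle_ineq4[of "E (x + \<tau> *\<^sub>R v + s *\<^sub>R w)" "E (x + \<tau> *\<^sub>R v)"] E[of s] E[of 0] s by simp
      qed (use s e M in \<open>auto simp: M_def\<close>)
      finally show ?thesis using s by simp
    qed
    finally show "\<bar>F (x + s *\<^sub>R v + s *\<^sub>R w) - F (x + s *\<^sub>R v) - F (x + s *\<^sub>R w) + F x - s\<^sup>2 * (v \<bullet> (A *v w))\<bar>
      \<le> s\<^sup>2 * (2 * e * M\<^sup>2)"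
      by (simp add: power2_eq_square algebra_simps)
  qed
qed

text \<open>
  The second difference does not change when \<open>v\<close> and \<open>w\<close> are exchanged, so after division by \<open>s\<^sup>2\<close> it
  approximates both sides (the theorem of Young).
\<close>

lemma symmetric_second_derivative:
  fixes F :: "real ^ 'n::finite \<Rightarrow> real"
  assumes S: "open S" "x \<in> S"
    and dF: "\<And>y. y \<in> S \<Longrightarrow> (F has_derivative (\<lambda>h. G y \<bullet> h)) (at y)"
    and dG: "(G has_derivative (\<lambda>h. A *v h)) (at x)"
  shows "v \<bullet> (A *v w) = w \<bullet> (A *v v)"
proof -
  define N where "N = (norm v + norm w)\<^sup>2"
  have bound: "\<bar>v \<bullet> (A *v w) - w \<bullet> (A *v v)\<bar> \<le> 4 * e * N" if e: "e > 0" for e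
  proof -
    have approx: "\<forall>\<^sub>F s in at_right 0. \<bar>F (x + s *\<^sub>R a + s *\<^sub>R b) - F (x + s *\<^sub>R a) - F (x + s *\<^sub>R b) + F x
        - s\<^sup>2 * (a \<bullet> (A *v b))\<bar> \<le> s\<^sup>2 * (2 * e * (norm a + norm b)\<^sup>2)" for a b
      by (rule second_difference_approx[OF S dF dG e])
    define D where "D s = F (x + s *\<^sub>R v + s *\<^sub>R w) - F (x + s *\<^sub>R v) - F (x + s *\<^sub>R w) + F x" for s
    have "\<forall>\<^sub>F s in at_right 0. \<bar>D s - s\<^sup>2 * (v \<bullet> (A *v w))\<bar> \<le> s\<^sup>2 * (2 * e * N)"
      using approx[of v w] by (simp add: D_def N_def)
    moreover have "\<forall>\<^sub>F s in at_right 0. \<bar>D s - s\<^sup>2 * (w \<bullet> (A *v v))\<bar> \<le> s\<^sup>2 * (2 * e * N)"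
      using approx[of w v] by (simp add: D_def N_def algebra_simps)
    moreover have "\<forall>\<^sub>F s in at_right (0::real). 0 < s"
      by (rule eventually_at_right_less)
    ultimately have "\<forall>\<^sub>F s in at_right 0. \<bar>D s - s\<^sup>2 * (v \<bullet> (A *v w))\<bar> \<le> s\<^sup>2 * (2 * e * N)
        \<and> \<bar>D s - s\<^sup>2 * (w \<bullet> (A *v v))\<bar> \<le> s\<^sup>2 * (2 * e * N) \<and> 0 < s"
      by (intro eventually_conj)
    then obtain s where s: "0 < s" and D: "\<bar>D s - s\<^sup>2 * (v \<bullet> (A *v w))\<bar> \<le> s\<^sup>2 * (2 * e * N)"
      "\<bar>D s - s\<^sup>2 * (w \<bullet> (A *v v))\<bar> \<le> s\<^sup>2 * (2 * e * N)"
      using eventually_happens'[OF trivial_limit_at_right_real] by blast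
    have "\<bar>s\<^sup>2 * (v \<bullet> (A *v w)) - s\<^sup>2 * (w \<bullet> (A *v v))\<bar> \<le> s\<^sup>2 * (4 * e * N)"
      using D by (simp add: abs_le_iff)
    then have "s\<^sup>2 * \<bar>v \<bullet> (A *v w) - w \<bullet> (A *v v)\<bar> \<le> s\<^sup>2 * (4 * e * N)"
      by (simp add: abs_mult flip: right_diff_distrib)
    then show ?thesis using s by simp
  qed
  have "\<bar>v \<bullet> (A *v w) - w \<bullet> (A *v v)\<bar> \<le> 0"
  proof (rule field_le_epsilon)
    fix e :: real assume e: "e > 0"
    have "\<bar>v \<bullet> (A *v w) - w \<bullet> (A *v v)\<bar> \<le> 4 * (e / (4 * (1 + N))) * N"
      using e by (intro bound) (simp add: N_def add_pos_nonneg)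
    also have "\<dots> \<le> e"
      using e by (simp add: N_def divide_simps add_pos_nonneg mult_left_mono)
    finally show "\<bar>v \<bullet> (A *v w) - w \<bullet> (A *v v)\<bar> \<le> 0 + e" by simp
  qed
  then show ?thesis by simp
qed

lemma second_order_lower_bound:
  fixes F :: "real ^ 'n::finite \<Rightarrow> real"
  assumes "R > 0"
    and dF: "\<And>t. 0 \<le> t \<Longrightarrow> t \<le> R \<Longrightarrow> (F has_derivative (\<lambda>h. G (x + t *\<^sub>R v) \<bullet> h)) (at (x + t *\<^sub>R v))"
    and dG: "\<And>t. 0 \<le> t \<Longrightarrow> t \<le> R \<Longrightarrow> (G has_derivative (\<lambda>h. H (x + t *\<^sub>R v) *v h)) (at (x + t *\<^sub>R v))"
    and H: "\<And>t. 0 \<le> t \<Longrightarrow> t \<le> R \<Longrightarrow> b \<le> v \<bullet> (H (x + t *\<^sub>R v) *v v)"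
  shows "F x + R * (G x \<bullet> v) + b * R\<^sup>2 / 2 \<le> F (x + R *\<^sub>R v)"
proof -
  define diff where "diff = (\<lambda>(m::nat) t. if m = 0 then F (x + t *\<^sub>R v) else if m = 1 then G (x + t *\<^sub>R v) \<bullet> v
      else v \<bullet> (H (x + t *\<^sub>R v) *v v))"
  have "\<exists>t. 0 < t \<and> t < R \<and>
      F (x + R *\<^sub>R v) = (\<Sum>m<2. (diff m 0 / fact m) * (R - 0)^m) + (diff 2 t / fact 2) * (R - 0)^2"
  proof (rule Taylor_up)
    show "\<forall>m t. m < 2 \<and> 0 \<le> t \<and> t \<le> R \<longrightarrow> DERIV (diff m) t :> diff (Suc m) t"
      using dF dG
      by (auto simp: diff_def less_2_cases_iff
          intro!: has_real_derivative_along_line has_real_derivative_gradient_along_line)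
  qed (use \<open>R > 0\<close> in \<open>auto simp: diff_def\<close>)
  then obtain t where t: "0 < t" "t < R"
    and eq: "F (x + R *\<^sub>R v) = F x + R * (G x \<bullet> v) + (v \<bullet> (H (x + t *\<^sub>R v) *v v)) / 2 * R\<^sup>2"
    by (auto simp: diff_def numeral_2_eq_2 fact_numeral algebra_simps)
  have "b / 2 * R\<^sup>2 \<le> (v \<bullet> (H (x + t *\<^sub>R v) *v v)) / 2 * R\<^sup>2"
    using H[of t] t by (intro mult_right_mono) auto
  then show ?thesis unfolding eq by simp
qed

text \<open>
  Only the derivative \<open>l\<close> of \<open>g'\<close> at \<open>0\<close> is at hand: since \<open>g' 0 = 0\<close>, a positive \<open>l\<close> would make \<open>g'\<close>
  positive, and hence \<open>g\<close> increasing, just to the right of \<open>0\<close>.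
\<close>

lemma second_derivative_nonpos_at_local_max:
  fixes g g' :: "real \<Rightarrow> real"
  assumes "d > 0"
    and dg: "\<And>t. \<bar>t\<bar> < d \<Longrightarrow> (g has_real_derivative g' t) (at t)"
    and dg': "(g' has_real_derivative l) (at 0)"
    and max: "\<And>t. \<bar>t\<bar> < d \<Longrightarrow> g t \<le> g 0"
  shows "l \<le> 0"
proof (rule ccontr)
  assume "\<not> l \<le> 0"
  have "g' 0 = 0"
    using DERIV_local_max[OF dg[of 0] \<open>d > 0\<close>] max \<open>d > 0\<close> by simp
  then obtain r where r: "r > 0" and pos: "\<And>h. 0 < h \<Longrightarrow> h < r \<Longrightarrow> 0 < g' h"
    using DERIV_pos_inc_right[OF dg'] \<open>\<not> l \<le> 0\<close> by auto
  define s where "s = min r d / 2"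
  have s: "0 < s" "s < r" "s < d" using r \<open>d > 0\<close> by (auto simp: s_def)
  obtain z where z: "0 < z" "z < s" "g s - g 0 = (s - 0) * g' z"
    using MVT2[OF s(1), of g g'] dg s by auto
  then have "g s > g 0" using pos[of z] s by (simp add: algebra_simps)
  with max[of s] s show False by simp
qed

section \<open>Phase estimates\<close>

text \<open>
  The other \<open>n - 1\<close> summands contribute less than \<open>(n - 1) \<pi>/2\<close>, which leaves at least \<open>\<delta> - \<pi>/2\<close> for
  \<open>arctan (lam i)\<close>. The bound \<open>tan (\<delta> - \<pi>/2)\<close> is \<open>- cot \<delta>\<close>.
\<close>

lemma eigenvalue_ge_of_supercritical_phase:
  fixes lam :: "'n::finite \<Rightarrow> real"
  assumes "\<delta> > 0" and phase: "(real CARD('n) - 2) * (pi / 2) + \<delta> \<le> (\<Sum>i\<in>UNIV. arctan (lam i))"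
  shows "tan (\<delta> - pi / 2) \<le> lam i"
proof -
  note phase
  also have "(\<Sum>j\<in>UNIV. arctan (lam j)) = arctan (lam i) + (\<Sum>j\<in>UNIV - {i}. arctan (lam j))"
    by (simp add: sum.remove)
  also have "(\<Sum>j\<in>UNIV - {i}. arctan (lam j)) \<le> (\<Sum>j\<in>UNIV - {i}. pi / 2)"
    by (intro sum_mono less_imp_le arctan_ubound)
  also have "\<dots> = (real CARD('n) - 1) * (pi / 2)"
    by (simp add: card_Diff_singleton of_nat_diff Suc_leI)
  finally have le: "\<delta> - pi / 2 \<le> arctan (lam i)"
    by (simp add: algebra_simps diff_divide_distrib)
  \<comment> \<open>The phase is below \<open>n \<pi>/2\<close>, so \<open>\<delta> < \<pi>\<close> and \<open>\<delta> - \<pi>/2\<close> lies in the range of \<open>arctan\<close>.\<close>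
  then have "\<delta> - pi / 2 < pi / 2" using arctan_ubound[of "lam i"] by linarith
  then have "arctan (tan (\<delta> - pi / 2)) = \<delta> - pi / 2"
    using \<open>\<delta> > 0\<close> by (intro arctan_tan) auto
  with le show ?thesis by (metis arctan_le_iff)
qed

text \<open>
  Otherwise each summand \<open>arctan (lam i)\<close> would be at most \<open>\<delta> / (2 n)\<close>, because \<open>arctan t \<le> t\<close> for \<open>t \<ge> 0\<close>,
  and the phase at most \<open>\<delta> / 2\<close>.
\<close>

lemma exists_large_eigenvalue:
  fixes lam :: "'n::finite \<Rightarrow> real"
  assumes "\<delta> > 0" "CARD('n) \<ge> 2"
    and phase: "(real CARD('n) - 2) * (pi / 2) + \<delta> \<le> (\<Sum>i\<in>UNIV. arctan (lam i))"
  shows "\<exists>i. \<delta> / (2 * real CARD('n)) < lam i"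
proof (rule ccontr)
  assume "\<not> ?thesis"
  then have le: "lam i \<le> \<delta> / (2 * real CARD('n))" for i by (simp add: not_less)
  have "(\<Sum>i\<in>UNIV. arctan (lam i)) \<le> (\<Sum>i::'n\<in>UNIV. \<delta> / (2 * real CARD('n)))"
  proof (rule sum_mono)
    fix i
    have "arctan (lam i) \<le> arctan (\<delta> / (2 * real CARD('n)))" using le by (simp add: arctan_le_iff)
    also have "\<dots> \<le> \<delta> / (2 * real CARD('n))" using assms(1) by (intro arctan_le_self) simp
    finally show "arctan (lam i) \<le> \<delta> / (2 * real CARD('n))" .
  qed
  also have "\<dots> = \<delta> / 2" by simp
  finally have "(real CARD('n) - 2) * (pi / 2) + \<delta> \<le> \<delta> / 2" using phase by simp
  moreover have "(real CARD('n) - 2) * (pi / 2) \<ge> 0" using assms(2) by simp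
  ultimately show False using assms(1) by simp
qed

section \<open>Quadratic growth and the gradient bound for positive phase\<close>

text \<open>
  A maximum of \<open>F - \<epsilon> \<bar>y\<bar>\<^sup>2\<close> over the closed ball cannot be interior: along the line in the direction \<open>v\<close>
  given by the hypothesis the second derivative there is positive. The boundary maximum is then compared with
  the value at the centre.
\<close>

lemma quadratic_growth:
  fixes F :: "real ^ 'n::finite \<Rightarrow> real"
  assumes "r > 0" "r < \<rho>"
    and dF: "\<And>y. y \<in> ball 0 \<rho> \<Longrightarrow> (F has_derivative (\<lambda>h. G y \<bullet> h)) (at y)"
    and dG: "\<And>y. y \<in> ball 0 \<rho> \<Longrightarrow> (G has_derivative (\<lambda>h. H y *v h)) (at y)"
    and H: "\<And>y. y \<in> ball 0 \<rho> \<Longrightarrow> \<exists>v. v \<bullet> (H y *v v) > 2 * \<epsilon> * (v \<bullet> v)"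
  shows "\<exists>y. norm y = r \<and> F 0 + \<epsilon> * r\<^sup>2 \<le> F y"
proof -
  define W where "W y = F y - \<epsilon> * (y \<bullet> y)" for y
  have "continuous_on (cball 0 r) F"
  proof (rule has_derivative_continuous_on)
    fix y :: "real ^ 'n" assume "y \<in> cball 0 r"
    then have "y \<in> ball 0 \<rho>" using \<open>r < \<rho>\<close> by simp
    from has_derivative_at_withinI[OF dF[OF this]]
    show "(F has_derivative (\<lambda>h. G y \<bullet> h)) (at y within cball 0 r)" .
  qed
  then have "continuous_on (cball 0 r) W"
    unfolding W_def by (intro continuous_intros)
  then obtain y where y: "norm y \<le> r" and max: "\<And>z. norm z \<le> r \<Longrightarrow> W z \<le> W y"
    using continuous_attains_sup[OF compact_cball, of 0 r W] \<open>r > 0\<close> by auto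
  have "norm y = r"
  proof (rule ccontr)
    assume "norm y \<noteq> r"
    with y have yr: "norm y < r" by simp
    with \<open>r < \<rho>\<close> obtain v where v: "v \<bullet> (H y *v v) > 2 * \<epsilon> * (v \<bullet> v)" using H[of y] by auto
    define d where "d = (r - norm y) / (1 + norm v)"
    have pos: "1 + norm v > 0" by (simp add: add_pos_nonneg)
    have d: "d > 0" using yr pos by (simp add: d_def)
    have near: "norm (y + t *\<^sub>R v) < r" if "\<bar>t\<bar> < d" for t
    proof -
      have "norm (y + t *\<^sub>R v) \<le> norm y + \<bar>t\<bar> * norm v" by (metis norm_scaleR norm_triangle_ineq)
      also have "\<dots> \<le> norm y + \<bar>t\<bar> * (1 + norm v)" by (simp add: mult_left_mono)
      also have "\<dots> < r" using that pos by (simp add: d_def pos_less_divide_eq)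
      finally show ?thesis .
    qed
    have "v \<bullet> (H y *v v) - 2 * \<epsilon> * (v \<bullet> v) \<le> 0"
    proof (rule second_derivative_nonpos_at_local_max[OF d])
      fix t :: real assume t: "\<bar>t\<bar> < d"
      have "(F has_derivative (\<lambda>h. G (y + t *\<^sub>R v) \<bullet> h)) (at (y + t *\<^sub>R v))"
        using near[OF t] \<open>r < \<rho>\<close> by (intro dF) simp
      then have "(W has_derivative (\<lambda>h. (G (y + t *\<^sub>R v) - (2 * \<epsilon>) *\<^sub>R (y + t *\<^sub>R v)) \<bullet> h)) (at (y + t *\<^sub>R v))"
        unfolding W_def
        by (auto intro!: derivative_eq_intros simp: fun_eq_iff inner_diff_left inner_add_left inner_add_right inner_commute algebra_simps)
      from has_real_derivative_along_line[OF this]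
      show "((\<lambda>t. W (y + t *\<^sub>R v)) has_real_derivative
              (G (y + t *\<^sub>R v) - (2 * \<epsilon>) *\<^sub>R (y + t *\<^sub>R v)) \<bullet> v) (at t)" .
      show "W (y + t *\<^sub>R v) \<le> W (y + 0 *\<^sub>R v)"
        using near[OF t] max by simp
    next
      have "(G has_derivative (\<lambda>h. H y *v h)) (at (y + 0 *\<^sub>R v))"
        using dG[of y] yr \<open>r < \<rho>\<close> by simp
      from has_real_derivative_gradient_along_line[OF this, of v]
      have 1: "((\<lambda>t. G (y + t *\<^sub>R v) \<bullet> v) has_real_derivative v \<bullet> (H y *v v)) (at 0)" .
      have 2: "((\<lambda>t. 2 * \<epsilon> * (y \<bullet> v + t * (v \<bullet> v))) has_real_derivative 2 * \<epsilon> * (v \<bullet> v)) (at 0)"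
        by (auto intro!: derivative_eq_intros)
      show "((\<lambda>t. (G (y + t *\<^sub>R v) - (2 * \<epsilon>) *\<^sub>R (y + t *\<^sub>R v)) \<bullet> v)
              has_real_derivative v \<bullet> (H y *v v) - 2 * \<epsilon> * (v \<bullet> v)) (at 0)"
        using DERIV_diff[OF 1 2] by (simp add: inner_diff_left inner_add_left)
    qed
    with v show False by simp
  qed
  moreover have "F 0 + \<epsilon> * r\<^sup>2 \<le> F y"
    using max[of 0] \<open>norm y = r\<close> \<open>r > 0\<close> by (simp add: W_def dot_square_norm)
  ultimately show ?thesis by blast
qed

text \<open>
  With \<open>c = \<bar>tan (\<delta> - \<pi>/2)\<bar>\<close> and \<open>\<epsilon> = \<delta> / (4 n)\<close> this is \<open>1 + c / (8 \<epsilon>)\<close>.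
\<close>

definition gradient_constant :: "nat \<Rightarrow> real \<Rightarrow> real" where
  "gradient_constant n \<delta> = 1 + real n * \<bar>tan (\<delta> - pi / 2)\<bar> / (2 * \<delta>)"

text \<open>
  Semiconvexity gives \<open>\<bar>G x\<bar> \<le> d\<^sub>1 + c R / 2\<close> for one difference quotient \<open>d\<^sub>1\<close> of values of \<open>F\<close>, and quadratic
  growth gives \<open>4 \<epsilon> R \<le> d\<^sub>2\<close> for another. The larger of the two serves as \<open>(F a - F b) / R\<close>; stating
  the bound with attained values keeps the extended reals out of the argument.
\<close>

lemma gradient_estimate_positive_phase:
  fixes F :: "real ^ 'n::finite \<Rightarrow> real"
  assumes "CARD('n) \<ge> 2" "\<delta> > 0" "R > 0"
    and dF: "\<And>y. y \<in> ball 0 (3 * R) \<Longrightarrow> (F has_derivative (\<lambda>h. G y \<bullet> h)) (at y)"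
    and dG: "\<And>y. y \<in> ball 0 (3 * R) \<Longrightarrow> (G has_derivative (\<lambda>h. H y *v h)) (at y)"
    and eig: "\<And>y. y \<in> ball 0 (3 * R) \<Longrightarrow>
      \<exists>lam. eigenvalues (H y) lam \<and> (real CARD('n) - 2) * (pi / 2) + \<delta> \<le> (\<Sum>i\<in>UNIV. arctan (lam i))"
    and x: "x \<in> ball 0 R"
  shows "\<exists>a\<in>ball 0 (3 * R). \<exists>b\<in>ball 0 (3 * R). norm (G x) \<le> gradient_constant (CARD('n)) \<delta> * ((F a - F b) / R)"
proof -
  define n where "n = real CARD('n)"
  have n: "n > 0" by (simp add: n_def)
  define c where "c = \<bar>tan (\<delta> - pi / 2)\<bar>"
  define \<epsilon> where "\<epsilon> = \<delta> / (4 * n)"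
  have \<epsilon>: "\<epsilon> > 0" using \<open>\<delta> > 0\<close> n by (simp add: \<epsilon>_def)
  have sym: "v \<bullet> (H y *v w) = w \<bullet> (H y *v v)" if "y \<in> ball 0 (3 * R)" for y v w
    by (rule symmetric_second_derivative[OF open_ball that dF dG[OF that]])
  have semiconvex: "- c * (v \<bullet> v) \<le> v \<bullet> (H y *v v)" if y: "y \<in> ball 0 (3 * R)" for y v
  proof -
    obtain lam where lam: "eigenvalues (H y) lam"
      and ph: "(real CARD('n) - 2) * (pi / 2) + \<delta> \<le> (\<Sum>i\<in>UNIV. arctan (lam i))"
      using eig[OF y] by blast
    have "- c \<le> lam i" for i
      using eigenvalue_ge_of_supercritical_phase[OF \<open>\<delta> > 0\<close> ph, of i] by (simp add: c_def)
    from quadratic_form_ge[OF sym[OF y] lam this] show ?thesis .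
  qed
  \<comment> \<open>The direction of \<open>G x\<close>; if \<open>G x = 0\<close> then \<open>v = 0\<close>, and the argument still works.\<close>
  define v where "v = sgn (G x)"
  have v: "norm v \<le> 1" by (simp add: v_def norm_sgn)
  have v2: "v \<bullet> v \<le> 1" using v by (simp add: dot_square_norm power_le_one)
  have Gv: "G x \<bullet> v = norm (G x)"
    by (cases "G x = 0") (simp_all add: v_def sgn_div_norm dot_square_norm power2_eq_square)
  have seg: "norm (x + t *\<^sub>R v) < 3 * R" if "0 \<le> t" "t \<le> R" for t
  proof -
    have "norm (x + t *\<^sub>R v) \<le> norm x + t * norm v" using that by (metis abs_of_nonneg norm_scaleR norm_triangle_ineq)
    also have "t * norm v \<le> t" using v that by (simp add: mult_left_le)
    finally show ?thesis using that x \<open>R > 0\<close> by simp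
  qed
  have "F x + R * (G x \<bullet> v) + (- c) * R\<^sup>2 / 2 \<le> F (x + R *\<^sub>R v)"
  proof (rule second_order_lower_bound[OF \<open>R > 0\<close>])
    fix t assume t: "0 \<le> t" "t \<le> R"
    then have y: "x + t *\<^sub>R v \<in> ball 0 (3 * R)" using seg by simp
    show "- c \<le> v \<bullet> (H (x + t *\<^sub>R v) *v v)"
    proof -
      have "- c \<le> - c * (v \<bullet> v)" using v2 by (simp add: c_def mult_left_le)
      with semiconvex[OF y, of v] show ?thesis by simp
    qed
  qed (use seg in \<open>auto intro: dF dG\<close>)
  then have grad: "norm (G x) \<le> (F (x + R *\<^sub>R v) - F x) / R + c * R / 2"
    using \<open>R > 0\<close> by (simp add: Gv field_simps power2_eq_square)
  have "\<exists>y'. norm y' = 2 * R \<and> F 0 + \<epsilon> * (2 * R)\<^sup>2 \<le> F y'"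
  proof (rule quadratic_growth[where \<rho> = "3 * R" and G = G and H = H])
    fix y :: "real ^ 'n" assume y: "y \<in> ball 0 (3 * R)"
    obtain lam where lam: "eigenvalues (H y) lam"
      and ph: "(real CARD('n) - 2) * (pi / 2) + \<delta> \<le> (\<Sum>i\<in>UNIV. arctan (lam i))"
      using eig[OF y] by blast
    obtain i where "2 * \<epsilon> < lam i"
      using exists_large_eigenvalue[OF \<open>\<delta> > 0\<close> assms(1) ph] by (auto simp: \<epsilon>_def n_def field_simps)
    with eigenvalues_le[OF lam, of "2 * \<epsilon>" i]
    show "\<exists>v. v \<bullet> (H y *v v) > 2 * \<epsilon> * (v \<bullet> v)" by (meson not_le)
  qed (use \<open>R > 0\<close> in \<open>auto intro: dF dG\<close>)
  then obtain y' where y': "norm y' = 2 * R" "F 0 + \<epsilon> * (2 * R)\<^sup>2 \<le> F y'" by blast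
  define d1 where "d1 = (F (x + R *\<^sub>R v) - F x) / R"
  define d2 where "d2 = (F y' - F 0) / R"
  have d2: "4 * \<epsilon> * R \<le> d2"
    using y'(2) \<open>R > 0\<close> by (simp add: d2_def pos_le_divide_eq power2_eq_square algebra_simps)
  have C: "gradient_constant (CARD('n)) \<delta> = 1 + c / (8 * \<epsilon>)"
    using n \<open>\<delta> > 0\<close> by (simp add: gradient_constant_def c_def \<epsilon>_def n_def field_simps)
  have "c * R / 2 = c / (8 * \<epsilon>) * (4 * \<epsilon> * R)" using \<epsilon> by (simp add: field_simps)
  also have "\<dots> \<le> c / (8 * \<epsilon>) * d2"
    using d2 \<epsilon> by (intro mult_left_mono) (auto simp: c_def)
  finally have bound: "norm (G x) \<le> d1 + c / (8 * \<epsilon>) * d2" using grad by (simp add: d1_def)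
  have k: "0 \<le> c / (8 * \<epsilon>)" using \<epsilon> by (simp add: c_def)
  show ?thesis
  proof (cases "d1 \<le> d2")
    case True
    then have "norm (G x) \<le> gradient_constant (CARD('n)) \<delta> * ((F y' - F 0) / R)"
      using bound unfolding C d2_def[symmetric] by (simp add: algebra_simps)
    then show ?thesis using y'(1) \<open>R > 0\<close>
      by (intro bexI[of _ y'] bexI[of _ 0]) auto
  next
    case False
    then have "c / (8 * \<epsilon>) * d2 \<le> c / (8 * \<epsilon>) * d1" using k by (intro mult_left_mono) auto
    then have "norm (G x) \<le> gradient_constant (CARD('n)) \<delta> * ((F (x + R *\<^sub>R v) - F x) / R)"
      using bound unfolding C d1_def[symmetric] by (simp add: algebra_simps)
    then show ?thesis using x seg[of R] \<open>R > 0\<close>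
      by (intro bexI[of _ "x + R *\<^sub>R v"] bexI[of _ x]) auto
  qed
qed

section \<open>Gradients and Hessians of functions of several variables\<close>

lemma grad_has_derivative:
  assumes "f differentiable at (x :: real ^ 'n::finite)"
  shows "(f has_derivative (\<lambda>h. grad f x \<bullet> h)) (at x)"
proof -
  have lin: "linear (frechet_derivative f (at x))"
    using assms by (rule linear_frechet_derivative)
  have "frechet_derivative f (at x) h = grad f x \<bullet> h" for h
  proof -
    have "frechet_derivative f (at x) h = frechet_derivative f (at x) (\<Sum>i\<in>UNIV. (h $ i) *\<^sub>R axis i 1)"
      by (simp add: basis_expansion flip: scalar_mult_eq_scaleR)
    also have "\<dots> = grad f x \<bullet> h"
      by (simp add: linear_sum[OF lin] linear_scale[OF lin] grad_def partial_def inner_vec_def mult.commute)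
    finally show ?thesis .
  qed
  then have "frechet_derivative f (at x) = (\<lambda>h. grad f x \<bullet> h)"
    by (rule ext)
  with assms show ?thesis
    by (metis frechet_derivative_works)
qed

text \<open>
  The transpose appears because the entry \<open>(i, j)\<close> of the Hessian is \<open>\<partial>\<^sub>i \<partial>\<^sub>j f\<close>, so the gradient of the
  component \<open>\<partial>\<^sub>j f\<close> is its \<open>j\<close>-th column.
\<close>

lemma hessian_has_derivative:
  assumes "\<And>i. partial i f differentiable at (x :: real ^ 'n::finite)"
  shows "(grad f has_derivative (\<lambda>h. transpose (hessian f x) *v h)) (at x)"
proof (rule has_derivative_componentwise_within[THEN iffD2], rule ballI)
  fix b :: "real ^ 'n" assume "b \<in> Basis"
  then obtain i where b: "b = axis i 1" by (auto simp: Basis_vec_def)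
  have "(\<lambda>y. grad f y \<bullet> b) = partial i f"
    by (simp add: b inner_axis grad_def fun_eq_iff)
  moreover have "(\<lambda>h. (transpose (hessian f x) *v h) \<bullet> b) = (\<lambda>h. grad (partial i f) x \<bullet> h)"
  proof
    fix h :: "real ^ 'n"
    have "(transpose (hessian f x) *v h) \<bullet> b = (transpose (hessian f x) *v h) $ i"
      by (simp add: b inner_axis del: transpose_matrix_vector)
    also have "\<dots> = grad (partial i f) x \<bullet> h"
      by (simp add: matrix_vector_mult_def transpose_def hessian_def grad_def inner_vec_def
          del: transpose_matrix_vector)
    finally show "(transpose (hessian f x) *v h) \<bullet> b = grad (partial i f) x \<bullet> h" .
  qed
  ultimately show "((\<lambda>y. grad f y \<bullet> b) has_derivative (\<lambda>h. (transpose (hessian f x) *v h) \<bullet> b)) (at x)"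
    using grad_has_derivative[OF assms[of i]] by simp
qed

lemma eigenvalues_transpose:
  fixes A :: "real ^ 'n::finite ^ 'n"
  assumes "eigenvalues A lam"
  shows "eigenvalues (transpose A) lam"
  unfolding eigenvalues_def
proof
  fix t
  have "mat t - transpose A = transpose (mat t - A)"
    by (auto simp: vec_eq_iff transpose_def mat_def)
  then show "det (mat t - transpose A) = (\<Prod>i\<in>UNIV. t - lam i)"
    using assms by (simp add: eigenvalues_def)
qed

section \<open>Oscillation and sign of the phase\<close>

lemma ereal_difference_le_osc:
  assumes "a \<in> S" "b \<in> S"
  shows "ereal (f a - f b) \<le> osc S f"
  using ereal_minus_mono[OF SUP_upper[OF assms(1), of "\<lambda>x. ereal (f x)"] INF_lower[OF assms(2), of "\<lambda>x. ereal (f x)"]]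
  by (simp add: osc_def)

lemma constant_sign_if_abs_ge:
  fixes f :: "'a::topological_space \<Rightarrow> real"
  assumes "connected S" "continuous_on S f" "m > 0" "\<And>x. x \<in> S \<Longrightarrow> m \<le> \<bar>f x\<bar>"
  shows "(\<forall>x\<in>S. m \<le> f x) \<or> (\<forall>x\<in>S. m \<le> - f x)"
proof (rule ccontr)
  assume "\<not> ?thesis"
  then obtain x y where xy: "x \<in> S" "f x < m" "y \<in> S" "- f y < m" by (auto simp: not_le)
  then have "f x \<le> 0" "0 \<le> f y" using assms(4)[of x] assms(4)[of y] by auto
  then have "0 \<in> f ` S"
    using connected_continuous_image[OF assms(2,1)] xy
    by (meson connectedD_interval image_eqI)
  then show False using assms(3,4) by force
qed

theorem theorem1p2:
  assumes "CARD('n::finite) \<ge> 2"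
  shows "\<exists>C4::real. \<forall>\<delta>>0. \<forall>K\<ge>0. \<exists>C3::real. C3 > 0 \<and>
    (\<forall>R>0. \<forall>(\<psi> :: real ^ 'n \<Rightarrow> real) (u :: real ^ 'n \<Rightarrow> real).
       C11_on (ball 0 (3 * R)) \<psi> \<longrightarrow>
       (\<forall>x\<in>ball 0 (3 * R). \<bar>\<psi> x\<bar> \<ge> (real CARD('n) - 2) * (pi / 2) + \<delta>) \<longrightarrow>
       C1_norm (ball 0 (3 * R)) \<psi> \<le> ereal K \<longrightarrow>
       C_on 3 (ball 0 (3 * R)) u \<longrightarrow>
       lagrangian_phase_solution (ball 0 (3 * R)) \<psi> u \<longrightarrow>
       (SUP x\<in>ball 0 R. ereal (norm (grad u x)))
         \<le> ereal C3 * osc (ball 0 (3 * R)) (\<lambda>x. u x / R) + ereal C4)"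
proof (rule exI[of _ 0], intro allI impI)
  fix \<delta> K :: real assume \<delta>: "\<delta> > 0"
  define C where "C = gradient_constant (CARD('n)) \<delta>"
  have C: "C > 0" using \<delta> by (simp add: C_def gradient_constant_def add_pos_nonneg)
  have "(SUP x\<in>ball 0 R. ereal (norm (grad u x))) \<le> ereal C * osc (ball 0 (3 * R)) (\<lambda>x. u x / R) + ereal 0"
    if R: "R > 0" and \<psi>: "C11_on (ball 0 (3 * R)) \<psi>"
      and ph: "\<forall>x\<in>ball 0 (3 * R). \<bar>\<psi> x\<bar> \<ge> (real CARD('n) - 2) * (pi / 2) + \<delta>"
      and u: "C_on 3 (ball 0 (3 * R)) u"
      and sol: "lagrangian_phase_solution (ball 0 (3 * R)) \<psi> u"
    for R and \<psi> u :: "real ^ 'n \<Rightarrow> real"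
  proof -
    let ?B = "ball (0 :: real ^ 'n) (3 * R)"
    define m where "m = (real CARD('n) - 2) * (pi / 2) + \<delta>"
    have m: "m > 0" using assms \<delta> by (simp add: m_def add_nonneg_pos)
    have "continuous_on ?B \<psi>"
      using \<psi> by (auto simp: C11_on_def intro!: differentiable_imp_continuous_on simp: differentiable_on_def differentiable_at_withinI)
    then have sign: "(\<forall>x\<in>?B. m \<le> \<psi> x) \<or> (\<forall>x\<in>?B. m \<le> - \<psi> x)"
      using ph m by (intro constant_sign_if_abs_ge connected_ball) (auto simp: m_def)
    have du: "(u has_derivative (\<lambda>h. grad u y \<bullet> h)) (at y)"
      and dG: "(grad u has_derivative (\<lambda>h. transpose (hessian u y) *v h)) (at y)" if "y \<in> ?B" for y
    proof -
      have "u differentiable (at y)" "\<And>i. partial i u differentiable (at y)"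
        using u that by (simp_all add: numeral_3_eq_3)
      then show "(u has_derivative (\<lambda>h. grad u y \<bullet> h)) (at y)"
        "(grad u has_derivative (\<lambda>h. transpose (hessian u y) *v h)) (at y)"
        by (auto intro: grad_has_derivative hessian_has_derivative simp del: transpose_matrix_vector)
    qed
    have eig: "\<exists>lam. eigenvalues (transpose (hessian u y)) lam \<and> (\<Sum>i\<in>UNIV. arctan (lam i)) = \<psi> y" if "y \<in> ?B" for y
      using sol that eigenvalues_transpose by (fastforce simp: lagrangian_phase_solution_def)
    have "ereal (norm (grad u x)) \<le> ereal C * osc ?B (\<lambda>x. u x / R)" if x: "x \<in> ball 0 R" for x
    proof -
      have "\<exists>a\<in>?B. \<exists>b\<in>?B. norm (grad u x) \<le> C * ((u a - u b) / R)"
        using sign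
      proof
        assume pos: "\<forall>x\<in>?B. m \<le> \<psi> x"
        show ?thesis unfolding C_def
        proof (rule gradient_estimate_positive_phase[OF assms \<delta> R du dG _ x])
          fix y assume y: "y \<in> ?B"
          then show "\<exists>lam. eigenvalues (transpose (hessian u y)) lam \<and>
              (real CARD('n) - 2) * (pi / 2) + \<delta> \<le> (\<Sum>i\<in>UNIV. arctan (lam i))"
            using eig[OF y] pos by (auto simp: m_def)
        qed
      next
        assume neg: "\<forall>x\<in>?B. m \<le> - \<psi> x"
        have "\<exists>a\<in>?B. \<exists>b\<in>?B. norm (- grad u x) \<le> C * ((- u a - - u b) / R)"
          unfolding C_def
        proof (rule gradient_estimate_positive_phase[OF assms \<delta> R _ _ _ x])
          fix y assume y: "y \<in> ?B"
          show "((\<lambda>x. - u x) has_derivative (\<lambda>h. (- grad u y) \<bullet> h)) (at y)"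
            using has_derivative_minus[OF du[OF y]] by simp
          show "((\<lambda>x. - grad u x) has_derivative (\<lambda>h. (- transpose (hessian u y)) *v h)) (at y)"
          proof -
            have "(- transpose (hessian u y)) *v h = - (transpose (hessian u y) *v h)" for h
              by (simp add: matrix_vector_mult_def sum_negf vec_eq_iff)
            then show ?thesis
              using has_derivative_minus[OF dG[OF y]] by (simp del: transpose_matrix_vector)
          qed
          obtain lam where lam: "eigenvalues (transpose (hessian u y)) lam" "(\<Sum>i\<in>UNIV. arctan (lam i)) = \<psi> y"
            using eig[OF y] by blast
          then show "\<exists>lam. eigenvalues (- transpose (hessian u y)) lam \<and>
              (real CARD('n) - 2) * (pi / 2) + \<delta> \<le> (\<Sum>i\<in>UNIV. arctan (lam i))"
            using neg y
            by (intro exI[of _ "\<lambda>i. - lam i"]) (auto simp: eigenvalues_uminus arctan_minus sum_negf m_def)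
        qed
        then obtain a b where "a \<in> ?B" "b \<in> ?B" "norm (grad u x) \<le> C * ((u b - u a) / R)"
          by (auto simp: algebra_simps)
        then show ?thesis by blast
      qed
      then obtain a b where ab: "a \<in> ?B" "b \<in> ?B" "norm (grad u x) \<le> C * (u a / R - u b / R)"
        by (auto simp: diff_divide_distrib)
      have "ereal (norm (grad u x)) \<le> ereal C * ereal (u a / R - u b / R)"
        using ab(3) by simp
      also have "\<dots> \<le> ereal C * osc ?B (\<lambda>x. u x / R)"
        using ab C by (intro ereal_mult_left_mono ereal_difference_le_osc[where f = "\<lambda>x. u x / R"]) auto
      finally show ?thesis .
    qed
    then show ?thesis by (auto intro!: SUP_least)
  qed
  with C show "\<exists>C3>0. \<forall>R>0. \<forall>(\<psi> :: real ^ 'n \<Rightarrow> real) (u :: real ^ 'n \<Rightarrow> real).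
       C11_on (ball 0 (3 * R)) \<psi> \<longrightarrow>
       (\<forall>x\<in>ball 0 (3 * R). \<bar>\<psi> x\<bar> \<ge> (real CARD('n) - 2) * (pi / 2) + \<delta>) \<longrightarrow>
       C1_norm (ball 0 (3 * R)) \<psi> \<le> ereal K \<longrightarrow>
       C_on 3 (ball 0 (3 * R)) u \<longrightarrow>
       lagrangian_phase_solution (ball 0 (3 * R)) \<psi> u \<longrightarrow>
       (SUP x\<in>ball 0 R. ereal (norm (grad u x)))
         \<le> ereal C3 * osc (ball 0 (3 * R)) (\<lambda>x. u x / R) + ereal 0"
    by blast
qed

end
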